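(* Let $\mathcal{F}\subseteq\mathcal{P}(\mathbb{N})$ be a translation invariant and dilation invariant family with the Ramsey property. A measure preserving dynamical system $(X,\mathcal{B},\mu,T)$ is essential $\mathcal{F}^{\star}$ mixing if and only if for any $k\in\mathbb{N}$, any $A_0,A_1,\ldots,A_k\in\mathcal{B}$ with $\mu(A_0)\mu(A_1)\cdots\mu(A_k)>0$, any $n_1,\ldots,n_k\in\mathbb{N}$ with $n_1<\cdots<n_k$, and any $\varepsilon>0$, the set $$\left\{n\in\mathbb{N}:\left|\mu\left(A_0\cap T^{-nn_1}A_1\cap\cdots\cap T^{-nn_k}A_k\right)-\mu(A_0)\mu(A_1)\cdots\mu(A_k)\right|<\varepsilon\right\}$$ is an essential $\mathcal{F}^{\star}$ set.
   Context: $\mathbb{N}=\{1,2,3,\dots\}$. A family is a non-empty collection $\mathcal{F}\subseteq\mathcal{P}(\mathbb{N})$ that is upward hereditary (if $A\in\mathcal{F}$ and $A\subseteq B\subseteq\mathbb{N}$ then $B\in\mathcal{F}$); families are taken to be proper, i.e. $\emptyset\notin\mathcal{F}$. $\mathcal{F}$ has the Ramsey property if whenever $A\in\mathcal{F}$ and $A=A_1\cup A_2$, some $A_i\in\mathcal{F}$. For $x\in\mathbb{N}$, $A\subseteq\mathbb{N}$: $-x+A=\{y\in\mathbb{N}:x+y\in A\}$, $x+A=\{x+a:a\in A\}$, $xA=\{xa:a\in A\}$. $\mathcal{F}$ is translation invariant if $A\in\mathcal{F}$ and $n\in\mathbb{N}$ imply $n+A\in\mathcal{F}$ and $-n+A\in\mathcal{F}$;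 it is dilation invariant if $A\in\mathcal{F}$ and $n\in\mathbb{N}$ imply $nA\in\mathcal{F}$. $\beta\mathbb{N}$ is the set of ultrafilters on $\mathbb{N}$ with the operation: $A\in p+q$ iff $\{x\in\mathbb{N}:-x+A\in q\}\in p$. Let $\beta(\mathcal{F})=\{p\in\beta\mathbb{N}:p\subseteq\mathcal{F}\}$. A set is an essential $\mathcal{F}$ set if it belongs to some idempotent $p=p+p$ in $\beta(\mathcal{F})$. A set $A\subseteq\mathbb{N}$ is an essential $\mathcal{F}^{\star}$ set if it intersects every essential $\mathcal{F}$ set (equivalently, it belongs to every idempotent in $\beta(\mathcal{F})$). A measure preserving dynamical system $(X,\mathcal{B},\mu,T)$ consists of a Lebesgue probability space $(X,\mathcal{B},\mu)$, with $X$ a compact metric space, and an invertible measure preserving map $T:X\to X$. It is essential $\mathcal{F}^{\star}$ mixing if for any $A,B\in\mathcal{B}$ with $\mu(A)\mu(B)>0$ and any $\varepsilon>0$, the set $\{n\in\mathbb{N}:|\mu(A\cap T^{-n}B)-\mu(A)\mu(B)|<\varepsilon\}$ is an essential $\mathcal{F}^{\star}$ set. *)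

theory Defs
  imports "HOL-Probability.Probability"
begin

section \<open>Families of sets of positive integers\<close>

text \<open>The paper's natural numbers start at 1; they are the subset \<open>\<nat>\<^sub>1\<close> of type \<^typ>\<open>nat\<close>.\<close>

abbreviation Npos :: "nat set" (\<open>\<nat>\<^sub>1\<close>)
  where "\<nat>\<^sub>1 \<equiv> {1..}"

definition family :: "nat set set \<Rightarrow> bool" where
  "family \<F> \<longleftrightarrow> \<F> \<subseteq> Pow \<nat>\<^sub>1 \<and> \<F> \<noteq> {} \<and> {} \<notin> \<F> \<and>
     (\<forall>A B. A \<in> \<F> \<longrightarrow> A \<subseteq> B \<longrightarrow> B \<subseteq> \<nat>\<^sub>1 \<longrightarrow> B \<in> \<F>)"

definition ramsey_property :: "nat set set \<Rightarrow> bool" where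
  "ramsey_property \<F> \<longleftrightarrow> (\<forall>A A1 A2. A \<in> \<F> \<longrightarrow> A = A1 \<union> A2 \<longrightarrow> A1 \<in> \<F> \<or> A2 \<in> \<F>)"

definition shift_left :: "nat \<Rightarrow> nat set \<Rightarrow> nat set" where
  "shift_left x A = {y \<in> \<nat>\<^sub>1. x + y \<in> A}"

definition translation_invariant :: "nat set set \<Rightarrow> bool" where
  "translation_invariant \<F> \<longleftrightarrow>
     (\<forall>A\<in>\<F>. \<forall>n\<in>\<nat>\<^sub>1. (\<lambda>a. n + a) ` A \<in> \<F> \<and> shift_left n A \<in> \<F>)"

definition dilation_invariant :: "nat set set \<Rightarrow> bool" where
  "dilation_invariant \<F> \<longleftrightarrow> (\<forall>A\<in>\<F>. \<forall>n\<in>\<nat>\<^sub>1. (\<lambda>a. n * a) ` A \<in> \<F>)"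

section \<open>Ultrafilters and essential sets\<close>

definition ultrafilter_on :: "'a set \<Rightarrow> 'a set set \<Rightarrow> bool" where
  "ultrafilter_on S p \<longleftrightarrow> p \<subseteq> Pow S \<and> S \<in> p \<and> {} \<notin> p \<and>
     (\<forall>A\<in>p. \<forall>B\<in>p. A \<inter> B \<in> p) \<and>
     (\<forall>A B. A \<in> p \<longrightarrow> A \<subseteq> B \<longrightarrow> B \<subseteq> S \<longrightarrow> B \<in> p) \<and>
     (\<forall>A. A \<subseteq> S \<longrightarrow> A \<in> p \<or> S - A \<in> p)"

definition betaN :: "nat set set set" where
  "betaN = {p. ultrafilter_on \<nat>\<^sub>1 p}"

definition uf_plus :: "nat set set \<Rightarrow> nat set set \<Rightarrow> nat set set" where
  "uf_plus p q = {A. A \<subseteq> \<nat>\<^sub>1 \<and> {x \<in> \<nat>\<^sub>1. shift_left x A \<in> q} \<in> p}"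

definition beta_family :: "nat set set \<Rightarrow> nat set set set" where
  "beta_family \<F> = {p \<in> betaN. p \<subseteq> \<F>}"

definition essential_set :: "nat set set \<Rightarrow> nat set \<Rightarrow> bool" where
  "essential_set \<F> A \<longleftrightarrow> (\<exists>p\<in>beta_family \<F>. uf_plus p p = p \<and> A \<in> p)"

definition essential_star_set :: "nat set set \<Rightarrow> nat set \<Rightarrow> bool" where
  "essential_star_set \<F> A \<longleftrightarrow> A \<subseteq> \<nat>\<^sub>1 \<and> (\<forall>B. essential_set \<F> B \<longrightarrow> A \<inter> B \<noteq> {})"

section \<open>Measure preserving systems on Lebesgue spaces\<close>

definition isomorphic_mod0 :: "'a measure \<Rightarrow> 'b measure \<Rightarrow> bool" where
  "isomorphic_mod0 M N \<longleftrightarrow>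
     (\<exists>X0 \<in> sets M. \<exists>Y0 \<in> sets N. \<exists>\<phi>.
        space M - X0 \<in> null_sets M \<and> space N - Y0 \<in> null_sets N \<and>
        bij_betw \<phi> X0 Y0 \<and>
        \<phi> \<in> measurable (restrict_space M X0) (restrict_space N Y0) \<and>
        the_inv_into X0 \<phi> \<in> measurable (restrict_space N Y0) (restrict_space M X0) \<and>
        distr (restrict_space M X0) (restrict_space N Y0) \<phi> = restrict_space N Y0)"

text \<open>A Lebesgue space is, modulo null sets, the disjoint union of countably many points (the
  set \<open>D\<close>) and an interval \<open>[0,s]\<close> with Lebesgue measure; \<open>s = 0\<close> is the purely atomic case.
  The requirement is put on the completion of \<open>M\<close>, which changes nothing if \<open>M\<close> is complete.
  This way both usual conventions are covered: complete \<open>M\<close>, and the Borel sets as \<open>sets M\<close>.\<close>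

definition lebesgue_prob_space :: "'a measure \<Rightarrow> bool" where
  "lebesgue_prob_space M \<longleftrightarrow> prob_space M \<and>
     (\<exists>D s. countable D \<and> D \<subseteq> space M \<and> (\<forall>x\<in>D. {x} \<in> sets (completion M)) \<and> 0 \<le> s \<and>
        isomorphic_mod0 (restrict_space (completion M) (space M - D)) (lebesgue_on {0..s::real}))"

text \<open>\<open>d\<close> is the metric on the carrier \<open>space M\<close>, and its open sets are measurable. Only the values
  of \<open>d\<close> and \<open>T\<close> on the carrier matter.\<close>

locale measure_preserving_system =
  Metric_space "space M" d for M :: "'a measure" and d :: "'a \<Rightarrow> 'a \<Rightarrow> real" +
  fixes T :: "'a \<Rightarrow> 'a"
  assumes lebesgue: "lebesgue_prob_space M"
    and compact: "compact_space mtopology"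
    and open_measurable: "\<And>U. openin mtopology U \<Longrightarrow> U \<in> sets M"
    and invertible: "bij_betw T (space M) (space M)"
    and T_measurable: "T \<in> measurable M M"
    and T_inv_measurable: "the_inv_into (space M) T \<in> measurable M M"
    and T_preserving: "distr M M T = M"

definition pullback :: "'a measure \<Rightarrow> ('a \<Rightarrow> 'a) \<Rightarrow> nat \<Rightarrow> 'a set \<Rightarrow> 'a set" where
  "pullback M T n A = (T ^^ n) -` A \<inter> space M"

definition essential_star_mixing :: "nat set set \<Rightarrow> 'a measure \<Rightarrow> ('a \<Rightarrow> 'a) \<Rightarrow> bool" where
  "essential_star_mixing \<F> M T \<longleftrightarrow>
     (\<forall>A\<in>sets M. \<forall>B\<in>sets M. \<forall>\<epsilon>>0. measure M A * measure M B > 0 \<longrightarrow>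
        essential_star_set \<F>
          {n \<in> \<nat>\<^sub>1. \<bar>measure M (A \<inter> pullback M T n B) - measure M A * measure M B\<bar> < \<epsilon>})"

end

theory Submission
  imports Defs
begin

text \<open>A set is an essential \<open>\<F>\<^sup>\<star>\<close> set iff it belongs to every idempotent \<open>p\<close> in \<open>\<beta>(\<F>)\<close>, so
  both sides of the equivalence say that certain correlations converge along every such \<open>p\<close>.
  The case \<open>k = 1\<close>, \<open>n\<^sub>1 = 1\<close> of the right-hand side is the definition of mixing. The other
  direction rests on two facts about a fixed \<open>p\<close>.

  First, if \<open>j \<ge> 1\<close> then the image \<open>jp\<close> of \<open>p\<close> under multiplication by \<open>j\<close> is again an
  idempotent in \<open>\<beta>(\<F>)\<close>, by dilation invariance. A limit of \<open>\<mu>(A \<inter> T\<^sup>-\<^sup>n B)\<close> along \<open>jp\<close> is a limit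
  of \<open>\<mu>(A \<inter> T\<^sup>-\<^sup>j\<^sup>n B)\<close> along \<open>p\<close>, so mixing gives pair correlations for every \<open>T\<^sup>j\<close>
  (\<open>essential_star_mixing_tendsto_dilate\<close>).

  Second, a bounded sequence of functions \<open>u\<^sub>n\<close> whose correlations
  \<open>\<langle>u\<^sub>n, u\<^bsub>n+h\<^esub>\<rangle>\<close> tend to \<open>0\<close>, first in \<open>n\<close> and then in \<open>h\<close>, along an idempotent \<open>p\<close> tends weakly to \<open>0\<close>
  along \<open>p\<close> (\<open>van_der_Corput\<close>). Idempotence is what produces arbitrarily long
  lists of indices with all pairwise correlations small (\<open>idempotent_ultra_chain\<close>), and no
  fixed \<open>f\<close> can correlate with many almost orthogonal functions.

  Van der Corput is applied to \<open>u\<^sub>n = \<Prod>\<^sub>i f\<^sub>i \<circ> T\<^bsup>n n\<^sub>i\<^esup> - c\<close> with \<open>c = \<Prod>\<^sub>i \<integral> f\<^sub>i\<close>, by induction on the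
  number of factors (\<open>multiple_mixing\<close>). The integral of a product of
  \<open>k\<close> factors involves, by invariance of the measure, only \<open>k - 1\<close> nonzero exponents, so the induction
  hypothesis evaluates \<open>\<langle>u\<^sub>n, u\<^bsub>n+h\<^esub>\<rangle>\<close> in the limit over \<open>n\<close> as
  \<open>\<Prod>\<^sub>i \<integral> f\<^sub>i (f\<^sub>i \<circ> T\<^bsup>h n\<^sub>i\<^esup>) - c\<^sup>2\<close>, and the pair correlations send this to \<open>0\<close> in the limit over \<open>h\<close>.\<close>

section \<open>Idempotent ultrafilters as filters\<close>

text \<open>Viewing ultrafilters as filters turns \<open>p\<close>-limits into ordinary limits. The last clause is the
  inclusion \<open>p \<subseteq> p + p\<close>, which for ultrafilters is the same as \<open>p = p + p\<close>.\<close>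

definition idempotent_ultra :: "nat filter \<Rightarrow> bool" where
  "idempotent_ultra F \<longleftrightarrow> F \<noteq> bot \<and>
     (\<forall>P. eventually P F \<or> eventually (\<lambda>n. \<not> P n) F) \<and>
     (\<forall>P. eventually P F \<longrightarrow> (\<forall>\<^sub>F h in F. \<forall>\<^sub>F n in F. P (h + n)))"

lemma ultrafilter_on_Diff: "ultrafilter_on S p \<Longrightarrow> A \<subseteq> S \<Longrightarrow> A \<in> p \<or> S - A \<in> p"
  unfolding ultrafilter_on_def by simp

lemma ultrafilter_on_mono: "ultrafilter_on S p \<Longrightarrow> A \<in> p \<Longrightarrow> A \<subseteq> B \<Longrightarrow> B \<subseteq> S \<Longrightarrow> B \<in> p"
proof -
  assume "ultrafilter_on S p"
  then have "\<forall>A B. A \<in> p \<longrightarrow> A \<subseteq> B \<longrightarrow> B \<subseteq> S \<longrightarrow> B \<in> p"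
    unfolding ultrafilter_on_def by (elim conjE)
  then show "A \<in> p \<Longrightarrow> A \<subseteq> B \<Longrightarrow> B \<subseteq> S \<Longrightarrow> B \<in> p" by blast
qed

lemma ultrafilter_on_Int: "ultrafilter_on S p \<Longrightarrow> A \<in> p \<Longrightarrow> B \<in> p \<Longrightarrow> A \<inter> B \<in> p"
  unfolding ultrafilter_on_def by simp

definition filter_of_uf :: "nat set set \<Rightarrow> nat filter" where
  "filter_of_uf p = Abs_filter (\<lambda>P. {n \<in> \<nat>\<^sub>1. P n} \<in> p)"

lemma eventually_filter_of_uf:
  assumes "p \<in> betaN"
  shows "eventually P (filter_of_uf p) \<longleftrightarrow> {n \<in> \<nat>\<^sub>1. P n} \<in> p"
proof -
  have u: "ultrafilter_on \<nat>\<^sub>1 p"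
    using assms by (simp add: betaN_def)
  have "is_filter (\<lambda>P. {n \<in> \<nat>\<^sub>1. P n} \<in> p)"
  proof
    have "{n \<in> \<nat>\<^sub>1. True} = \<nat>\<^sub>1" by blast
    then show "{n \<in> \<nat>\<^sub>1. True} \<in> p"
      using u unfolding ultrafilter_on_def by metis
  next
    fix P Q assume "{n \<in> \<nat>\<^sub>1. P n} \<in> p" "{n \<in> \<nat>\<^sub>1. Q n} \<in> p"
    then have "{n \<in> \<nat>\<^sub>1. P n} \<inter> {n \<in> \<nat>\<^sub>1. Q n} \<in> p" by (rule ultrafilter_on_Int[OF u])
    moreover have "{n \<in> \<nat>\<^sub>1. P n \<and> Q n} = {n \<in> \<nat>\<^sub>1. P n} \<inter> {n \<in> \<nat>\<^sub>1. Q n}" by auto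
    ultimately show "{n \<in> \<nat>\<^sub>1. P n \<and> Q n} \<in> p" by simp
  next
    fix P Q :: "nat \<Rightarrow> bool"
    assume "\<forall>n. P n \<longrightarrow> Q n" "{n \<in> \<nat>\<^sub>1. P n} \<in> p"
    then show "{n \<in> \<nat>\<^sub>1. Q n} \<in> p"
      using ultrafilter_on_mono[OF u, of "{n \<in> \<nat>\<^sub>1. P n}" "{n \<in> \<nat>\<^sub>1. Q n}"] by auto
  qed
  then show ?thesis
    unfolding filter_of_uf_def by (rule eventually_Abs_filter)
qed

lemma idempotent_ultra_filter_of_uf:
  assumes p: "p \<in> betaN" and idem: "uf_plus p p = p"
  shows "idempotent_ultra (filter_of_uf p)"
  unfolding idempotent_ultra_def
proof (intro conjI allI impI)
  have u: "ultrafilter_on \<nat>\<^sub>1 p"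
    using p by (simp add: betaN_def)
  show "filter_of_uf p \<noteq> bot"
    using u by (simp add: trivial_limit_def eventually_filter_of_uf[OF p] ultrafilter_on_def)
  fix P :: "nat \<Rightarrow> bool"
  have "{n \<in> \<nat>\<^sub>1. P n} \<in> p \<or> \<nat>\<^sub>1 - {n \<in> \<nat>\<^sub>1. P n} \<in> p"
    by (rule ultrafilter_on_Diff[OF u]) auto
  moreover have "\<nat>\<^sub>1 - {n \<in> \<nat>\<^sub>1. P n} = {n \<in> \<nat>\<^sub>1. \<not> P n}" by auto
  ultimately show "eventually P (filter_of_uf p) \<or> eventually (\<lambda>n. \<not> P n) (filter_of_uf p)"
    by (simp add: eventually_filter_of_uf[OF p])
  assume "eventually P (filter_of_uf p)"
  then have "{n \<in> \<nat>\<^sub>1. P n} \<in> uf_plus p p"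
    by (simp add: eventually_filter_of_uf[OF p] idem)
  then have "{h \<in> \<nat>\<^sub>1. shift_left h {n \<in> \<nat>\<^sub>1. P n} \<in> p} \<in> p"
    by (simp add: uf_plus_def)
  moreover have "shift_left h {n \<in> \<nat>\<^sub>1. P n} = {n \<in> \<nat>\<^sub>1. P (h + n)}" for h
    by (auto simp: shift_left_def)
  ultimately show "\<forall>\<^sub>F h in filter_of_uf p. \<forall>\<^sub>F n in filter_of_uf p. P (h + n)"
    by (simp add: eventually_filter_of_uf[OF p])
qed

text \<open>If \<open>A\<close> were not in \<open>p\<close>, its complement would be an essential set that \<open>A\<close> misses.\<close>

lemma essential_star_set_iff:
  "essential_star_set \<F> A \<longleftrightarrow>
     A \<subseteq> \<nat>\<^sub>1 \<and> (\<forall>p\<in>beta_family \<F>. uf_plus p p = p \<longrightarrow> A \<in> p)"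
proof (intro iffI conjI ballI impI)
  assume star: "essential_star_set \<F> A"
  then show sub: "A \<subseteq> \<nat>\<^sub>1" by (simp add: essential_star_set_def)
  fix p assume p: "p \<in> beta_family \<F>" "uf_plus p p = p"
  then have "ultrafilter_on \<nat>\<^sub>1 p" by (simp add: beta_family_def betaN_def)
  then have "A \<in> p \<or> \<nat>\<^sub>1 - A \<in> p"
    using sub by (rule ultrafilter_on_Diff)
  moreover have "\<nat>\<^sub>1 - A \<notin> p"
    using star p unfolding essential_star_set_def essential_set_def by (metis Diff_disjoint)
  ultimately show "A \<in> p" by blast
next
  assume *: "A \<subseteq> \<nat>\<^sub>1 \<and> (\<forall>p\<in>beta_family \<F>. uf_plus p p = p \<longrightarrow> A \<in> p)"
  have "A \<inter> B \<noteq> {}" if B: "essential_set \<F> B" for B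
  proof -
    obtain p where p: "p \<in> beta_family \<F>" "uf_plus p p = p" "B \<in> p"
      using B unfolding essential_set_def by blast
    then have "A \<inter> B \<in> p" "{} \<notin> p"
      using * by (auto simp: beta_family_def betaN_def ultrafilter_on_def)
    then show ?thesis by metis
  qed
  then show "essential_star_set \<F> A" using * by (simp add: essential_star_set_def)
qed

lemma essential_star_set_Collect_iff:
  "essential_star_set \<F> {n \<in> \<nat>\<^sub>1. P n} \<longleftrightarrow>
     (\<forall>p\<in>beta_family \<F>. uf_plus p p = p \<longrightarrow> eventually P (filter_of_uf p))"
proof -
  have "eventually P (filter_of_uf p) \<longleftrightarrow> {n \<in> \<nat>\<^sub>1. P n} \<in> p" if "p \<in> beta_family \<F>" for p
    using that by (intro eventually_filter_of_uf) (simp add: beta_family_def)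
  then show ?thesis
    unfolding essential_star_set_iff by auto
qed

section \<open>Dilations of idempotents\<close>

definition dilate_uf :: "nat \<Rightarrow> nat set set \<Rightarrow> nat set set" where
  "dilate_uf m p = {A. A \<subseteq> \<nat>\<^sub>1 \<and> {n \<in> \<nat>\<^sub>1. m * n \<in> A} \<in> p}"

lemma dilate_uf_betaN:
  assumes p: "p \<in> betaN" and m: "m \<in> \<nat>\<^sub>1"
  shows "dilate_uf m p \<in> betaN"
proof -
  have u: "ultrafilter_on \<nat>\<^sub>1 p" using p by (simp add: betaN_def)
  have pos: "m * n \<in> \<nat>\<^sub>1" if "n \<in> \<nat>\<^sub>1" for n using that m by simp
  have "\<nat>\<^sub>1 \<in> dilate_uf m p"
  proof -
    have "{n \<in> \<nat>\<^sub>1. m * n \<in> \<nat>\<^sub>1} = \<nat>\<^sub>1" using pos by blast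
    then show ?thesis using u by (simp add: dilate_uf_def ultrafilter_on_def)
  qed
  moreover have "{} \<notin> dilate_uf m p"
    using u by (simp add: dilate_uf_def ultrafilter_on_def)
  moreover have "A \<inter> B \<in> dilate_uf m p" if "A \<in> dilate_uf m p" "B \<in> dilate_uf m p" for A B
  proof -
    have "{n \<in> \<nat>\<^sub>1. m * n \<in> A \<inter> B} = {n \<in> \<nat>\<^sub>1. m * n \<in> A} \<inter> {n \<in> \<nat>\<^sub>1. m * n \<in> B}" by blast
    then show ?thesis using that by (auto simp: dilate_uf_def intro: ultrafilter_on_Int[OF u])
  qed
  moreover have "B \<in> dilate_uf m p" if "A \<in> dilate_uf m p" "A \<subseteq> B" "B \<subseteq> \<nat>\<^sub>1" for A B
  proof -
    have "{n \<in> \<nat>\<^sub>1. m * n \<in> A} \<in> p" using that by (simp add: dilate_uf_def)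
    then have "{n \<in> \<nat>\<^sub>1. m * n \<in> B} \<in> p"
      by (rule ultrafilter_on_mono[OF u]) (use that in auto)
    then show ?thesis using that by (simp add: dilate_uf_def)
  qed
  moreover have "A \<in> dilate_uf m p \<or> \<nat>\<^sub>1 - A \<in> dilate_uf m p" if "A \<subseteq> \<nat>\<^sub>1" for A
  proof -
    have "{n \<in> \<nat>\<^sub>1. m * n \<in> \<nat>\<^sub>1 - A} = \<nat>\<^sub>1 - {n \<in> \<nat>\<^sub>1. m * n \<in> A}"
      using m by auto
    moreover have "{n \<in> \<nat>\<^sub>1. m * n \<in> A} \<in> p \<or> \<nat>\<^sub>1 - {n \<in> \<nat>\<^sub>1. m * n \<in> A} \<in> p"
      by (rule ultrafilter_on_Diff[OF u]) auto
    ultimately show ?thesis using that by (simp add: dilate_uf_def)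
  qed
  moreover have "dilate_uf m p \<subseteq> Pow \<nat>\<^sub>1" by (auto simp: dilate_uf_def)
  ultimately show ?thesis unfolding betaN_def ultrafilter_on_def mem_Collect_eq
    by (intro conjI allI impI ballI)
qed

text \<open>A member \<open>A\<close> of the dilated ultrafilter contains \<open>mB\<close> for some \<open>B \<in> p \<subseteq> \<F>\<close>, namely for
  \<open>B = {n. mn \<in> A}\<close>.\<close>

lemma dilate_uf_beta_family:
  assumes "family \<F>" "dilation_invariant \<F>" and p: "p \<in> beta_family \<F>" and m: "m \<in> \<nat>\<^sub>1"
  shows "dilate_uf m p \<in> beta_family \<F>"
proof -
  have "A \<in> \<F>" if "A \<in> dilate_uf m p" for A
  proof -
    have "{n \<in> \<nat>\<^sub>1. m * n \<in> A} \<in> \<F>" and A: "A \<subseteq> \<nat>\<^sub>1"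
      using that p by (auto simp: dilate_uf_def beta_family_def)
    then have "(\<lambda>n. m * n) ` {n \<in> \<nat>\<^sub>1. m * n \<in> A} \<in> \<F>"
      using assms by (simp add: dilation_invariant_def)
    moreover have "(\<lambda>n. m * n) ` {n \<in> \<nat>\<^sub>1. m * n \<in> A} \<subseteq> A" by auto
    ultimately show ?thesis using \<open>family \<F>\<close> A unfolding family_def by blast
  qed
  moreover have "dilate_uf m p \<in> betaN"
    using p m by (intro dilate_uf_betaN) (auto simp: beta_family_def)
  ultimately show ?thesis by (auto simp: beta_family_def)
qed

text \<open>Multiplication by \<open>m\<close> distributes over addition, hence is a homomorphism on ultrafilters.\<close>

lemma dilate_uf_idempotent:
  assumes p: "p \<in> betaN" and idem: "uf_plus p p = p" and m: "m \<in> \<nat>\<^sub>1"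
  shows "uf_plus (dilate_uf m p) (dilate_uf m p) = dilate_uf m p"
proof -
  have shift: "{n \<in> \<nat>\<^sub>1. m * n \<in> shift_left (m * x) A} = shift_left x {n \<in> \<nat>\<^sub>1. m * n \<in> A}" for x A
    using m by (auto simp: shift_left_def distrib_left)
  have sub: "shift_left x A \<subseteq> \<nat>\<^sub>1" for x A by (auto simp: shift_left_def)
  have iff: "A \<in> dilate_uf m p \<longleftrightarrow> A \<subseteq> \<nat>\<^sub>1 \<and> {n \<in> \<nat>\<^sub>1. m * n \<in> A} \<in> p" for A
    by (simp add: dilate_uf_def)
  have "A \<in> uf_plus (dilate_uf m p) (dilate_uf m p) \<longleftrightarrow> A \<in> dilate_uf m p" for A
  proof -
    define E where "E = {y \<in> \<nat>\<^sub>1. shift_left y A \<in> dilate_uf m p}"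
    have E: "E \<subseteq> \<nat>\<^sub>1" by (auto simp: E_def)
    have preimage: "{x \<in> \<nat>\<^sub>1. m * x \<in> E} = {x \<in> \<nat>\<^sub>1. shift_left x {n \<in> \<nat>\<^sub>1. m * n \<in> A} \<in> p}"
      using m sub unfolding E_def iff mem_Collect_eq shift by auto
    have "E \<in> dilate_uf m p \<longleftrightarrow> {n \<in> \<nat>\<^sub>1. m * n \<in> A} \<in> uf_plus p p"
      unfolding iff preimage using E by (simp add: uf_plus_def subset_eq)
    then show ?thesis
      unfolding idem iff[of A] by (auto simp: uf_plus_def E_def)
  qed
  then show ?thesis by blast
qed

lemma eventually_filter_of_dilate_uf:
  assumes "p \<in> betaN" "m \<in> \<nat>\<^sub>1"
  shows "eventually P (filter_of_uf (dilate_uf m p)) \<longleftrightarrow>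
         (\<forall>\<^sub>F n in filter_of_uf p. P (m * n))"
proof -
  have "{n \<in> \<nat>\<^sub>1. m * n \<in> {n \<in> \<nat>\<^sub>1. P n}} = {n \<in> \<nat>\<^sub>1. P (m * n)}"
    using assms(2) by auto
  then have "{n \<in> \<nat>\<^sub>1. P n} \<in> dilate_uf m p \<longleftrightarrow> {n \<in> \<nat>\<^sub>1. P (m * n)} \<in> p"
    unfolding dilate_uf_def by auto
  then show ?thesis
    unfolding eventually_filter_of_uf[OF assms(1)]
      eventually_filter_of_uf[OF dilate_uf_betaN[OF assms]] .
qed

section \<open>The van der Corput inequality along an idempotent\<close>

text \<open>This is the inductive construction from the idempotent proof of Hindman's theorem. The list
  is built as \<open>n + L\<close> with a finite list \<open>L\<close> of offsets and a still undetermined \<open>n\<close>, such that almost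
  every \<open>n\<close> works. Replacing \<open>n\<close> by \<open>x + n\<close> for a suitable constant \<open>x\<close>, which idempotence
  permits, leaves room to put \<open>n\<close> itself in front: it is related to every \<open>n + (x + d)\<close> because
  \<open>x + d\<close> is a good difference.\<close>

lemma idempotent_ultra_chain:
  assumes F: "idempotent_ultra F" and C: "eventually C F"
    and R: "\<forall>\<^sub>F h in F. \<forall>\<^sub>F n in F. R n (n + h)"
  shows "\<exists>ys. length ys = r \<and> (\<forall>y\<in>set ys. C y) \<and> sorted_wrt R ys"
proof -
  \<comment> \<open>Elements of the list must also be good differences, for the sake of later steps.\<close>
  define G where "G h \<longleftrightarrow> C h \<and> (\<forall>\<^sub>F n in F. R n (n + h))" for h
  have G: "eventually G F" unfolding G_def using C R by (rule eventually_conj)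
  define Q where "Q L n \<longleftrightarrow> (\<forall>d\<in>set L. G (n + d)) \<and> sorted_wrt R (map (\<lambda>d. n + d) L)"
    for L n
  have ex: "\<exists>x. P x" if "eventually P F" for P
    using that F eventually_happens' by (auto simp: idempotent_ultra_def)
  have "\<exists>L. length L = r \<and> eventually (Q L) F"
  proof (induction r)
    case 0
    then show ?case by (simp add: Q_def)
  next
    case (Suc r)
    then obtain L where L: "length L = r" "eventually (Q L) F" by blast
    then have "\<forall>\<^sub>F x in F. Q L x \<and> (\<forall>\<^sub>F n in F. Q L (x + n))"
      using F by (auto simp: idempotent_ultra_def intro: eventually_conj)
    then obtain x where x: "Q L x" "\<forall>\<^sub>F n in F. Q L (x + n)" using ex by blast
    have "\<forall>\<^sub>F n in F. \<forall>d\<in>set L. R n (n + (x + d))"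
      using x(1) by (intro eventually_ball_finite) (auto simp: Q_def G_def)
    then have "\<forall>\<^sub>F n in F. Q (0 # map (\<lambda>d. x + d) L) n"
      using x(2) G
      by eventually_elim (auto simp: Q_def sorted_wrt_map ac_simps)
    then show ?case using L(1) by (intro exI[of _ "0 # map (\<lambda>d. x + d) L"]) simp
  qed
  then obtain L where "length L = r" "eventually (Q L) F" by blast
  moreover from this obtain x where "Q L x" using ex by blast
  ultimately show ?thesis
    by (intro exI[of _ "map (\<lambda>d. x + d) L"]) (auto simp: Q_def G_def)
qed

lemma simple_function_prod:
  fixes f :: "'i \<Rightarrow> 'a \<Rightarrow> 'b :: comm_monoid_mult"
  assumes "\<And>i. i \<in> I \<Longrightarrow> simple_function M (f i)"
  shows "simple_function M (\<lambda>x. \<Prod>i\<in>I. f i x)"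
proof (cases "finite I")
  case True
  then show ?thesis using assms by (induction I) (auto intro: simple_function_compose2)
qed simp

context finite_measure
begin

lemma integrable_simple: "simple_function M f \<Longrightarrow> integrable M (f :: 'a \<Rightarrow> real)"
  by (rule integrable_simple_function) auto

text \<open>If \<open>\<integral> f u\<^sub>n \<ge> \<epsilon>\<close> for almost all \<open>n\<close>, take a chain of \<open>r\<close> such indices with pairwise
  correlations below \<open>\<delta>\<close>. The sum \<open>S\<close> of the \<open>r\<close> functions has \<open>\<integral> f S \<ge> r \<epsilon>\<close> but
  \<open>\<integral> S\<^sup>2 \<le> r \<bar>K\<bar> + r\<^sup>2 \<delta>\<close>, which violates the Cauchy-Schwarz inequality for small \<open>\<delta>\<close> and large
  \<open>r\<close>. The latter is used in the form \<open>0 \<le> \<integral> (s f - S)\<^sup>2\<close>.\<close>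

lemma van_der_Corput_upper:
  fixes u :: "nat \<Rightarrow> 'a \<Rightarrow> real"
  assumes F: "idempotent_ultra F"
    and u: "\<And>n. simple_function M (u n)" and f: "simple_function M f"
    and K: "\<And>n. (\<integral>x. u n x * u n x \<partial>M) \<le> K"
    and corr: "\<And>\<delta>. \<delta> > 0 \<Longrightarrow> \<forall>\<^sub>F h in F. \<forall>\<^sub>F n in F. \<bar>\<integral>x. u n x * u (n + h) x \<partial>M\<bar> < \<delta>"
    and \<epsilon>: "\<epsilon> > 0"
  shows "\<forall>\<^sub>F n in F. (\<integral>x. f x * u n x \<partial>M) < \<epsilon>"
proof (rule ccontr)
  assume "\<not> ?thesis"
  then have C: "\<forall>\<^sub>F n in F. \<epsilon> \<le> (\<integral>x. f x * u n x \<partial>M)"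
    using F unfolding idempotent_ultra_def not_less[symmetric] by blast
  \<comment> \<open>The summand \<open>1\<close> keeps the denominator of \<open>t\<close> positive when \<open>f\<close> vanishes almost everywhere.\<close>
  define N where "N = (\<integral>x. f x * f x \<partial>M) + 1"
  have N: "N > 0" "(\<integral>x. f x * f x \<partial>M) \<le> N" unfolding N_def by (auto intro: add_nonneg_pos)
  define t where "t = \<epsilon> / N"
  define \<delta> where "\<delta> = \<epsilon> * t / 2"
  have "t > 0" "\<delta> > 0" using \<epsilon> N by (auto simp: t_def \<delta>_def)
  obtain r where r: "real r * \<delta> > \<bar>K\<bar>"
    using reals_Archimedean3[OF \<open>\<delta> > 0\<close>] by blast
  have "r > 0" using r by (cases r) auto
  obtain ys where ys: "length ys = r" "\<forall>y\<in>set ys. \<epsilon> \<le> (\<integral>x. f x * u y x \<partial>M)"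
      "sorted_wrt (\<lambda>y z. \<bar>\<integral>x. u y x * u z x \<partial>M\<bar> < \<delta>) ys"
    using idempotent_ultra_chain[OF F C corr[OF \<open>\<delta> > 0\<close>]] by blast
  define v where "v i = u (ys ! i)" for i
  have v: "simple_function M (v i)" for i by (simp add: v_def u)
  have int: "integrable M (\<lambda>x. g x * h x)" if "simple_function M g" "simple_function M h"
    for g h :: "'a \<Rightarrow> real" using that by (intro integrable_simple simple_function_mult)
  have lower: "real r * \<epsilon> \<le> (\<Sum>i<r. \<integral>x. f x * v i x \<partial>M)"
    using sum_bounded_below[of "{..<r}" \<epsilon> "\<lambda>i. \<integral>x. f x * v i x \<partial>M"] ys by (simp add: v_def)
  have cross: "(\<integral>x. v i x * v j x \<partial>M) \<le> \<delta> + (if i = j then \<bar>K\<bar> else 0)" if "i < r" "j < r" for i j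
  proof (cases i j rule: linorder_cases)
    case less
    then have "\<bar>\<integral>x. v i x * v j x \<partial>M\<bar> < \<delta>"
      using ys that by (auto simp: v_def dest: sorted_wrt_nth_less)
    then show ?thesis using less by simp
  next
    case equal
    then show ?thesis using K[of "ys ! i"] \<open>\<delta> > 0\<close> by (simp add: v_def)
  next
    case greater
    then have "\<bar>\<integral>x. v j x * v i x \<partial>M\<bar> < \<delta>"
      using ys that by (auto simp: v_def dest: sorted_wrt_nth_less)
    then show ?thesis using greater by (simp add: mult.commute)
  qed
  have "(\<Sum>i<r. \<Sum>j<r. \<integral>x. v i x * v j x \<partial>M)
      \<le> (\<Sum>i<r. \<Sum>j<r. \<delta> + (if i = j then \<bar>K\<bar> else 0))"
    by (intro sum_mono cross) auto
  also have "\<dots> = real r * (real r * \<delta> + \<bar>K\<bar>)"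
    by (simp add: sum.distrib distrib_left)
  also have "\<dots> < real r * (real r * \<delta> + real r * \<delta>)"
    using r \<open>r > 0\<close> by (intro mult_strict_left_mono add_strict_left_mono) auto
  finally have upper: "(\<Sum>i<r. \<Sum>j<r. \<integral>x. v i x * v j x \<partial>M) < (real r)\<^sup>2 * \<epsilon> * t"
    by (simp add: \<delta>_def power2_eq_square ac_simps)
  \<comment> \<open>This \<open>s = r \<epsilon> / N\<close> minimises \<open>s\<^sup>2 N - 2 s r \<epsilon>\<close>, with value \<open>- r\<^sup>2 \<epsilon> t\<close>.\<close>
  define s where "s = real r * t"
  have "0 \<le> (\<integral>x. (s * f x - (\<Sum>i<r. v i x))\<^sup>2 \<partial>M)" by simp
  also have "\<dots> = (\<integral>x. s\<^sup>2 * (f x * f x) - 2 * s * (\<Sum>i<r. f x * v i x)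
                    + (\<Sum>i<r. \<Sum>j<r. v i x * v j x) \<partial>M)"
  proof (intro Bochner_Integration.integral_cong refl)
    fix x
    have "(s * f x - (\<Sum>i<r. v i x))\<^sup>2 = s\<^sup>2 * (f x * f x) - 2 * s * (f x * (\<Sum>i<r. v i x))
        + (\<Sum>i<r. v i x) * (\<Sum>j<r. v j x)"
      by (simp add: power2_eq_square algebra_simps)
    then show "(s * f x - (\<Sum>i<r. v i x))\<^sup>2 = s\<^sup>2 * (f x * f x) - 2 * s * (\<Sum>i<r. f x * v i x)
        + (\<Sum>i<r. \<Sum>j<r. v i x * v j x)"
      unfolding sum_product sum_distrib_left[of "f x"] .
  qed
  also have "\<dots> = s\<^sup>2 * (\<integral>x. f x * f x \<partial>M) - 2 * s * (\<Sum>i<r. \<integral>x. f x * v i x \<partial>M)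
                    + (\<Sum>i<r. \<Sum>j<r. \<integral>x. v i x * v j x \<partial>M)"
    by (simp add: int f v)
  also have "\<dots> < s\<^sup>2 * N - 2 * s * (real r * \<epsilon>) + (real r)\<^sup>2 * \<epsilon> * t"
  proof -
    have "s \<ge> 0" using \<open>t > 0\<close> by (simp add: s_def)
    then have "2 * s * (real r * \<epsilon>) \<le> 2 * s * (\<Sum>i<r. \<integral>x. f x * v i x \<partial>M)"
      using lower by (intro mult_left_mono) auto
    moreover have "s\<^sup>2 * (\<integral>x. f x * f x \<partial>M) \<le> s\<^sup>2 * N" using N by (intro mult_left_mono) auto
    ultimately show ?thesis using upper by linarith
  qed
  also have "\<dots> = 0"
    using N by (simp add: s_def t_def power2_eq_square field_simps)
  finally show False by simp
qed

lemma van_der_Corput: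
  fixes u :: "nat \<Rightarrow> 'a \<Rightarrow> real"
  assumes F: "idempotent_ultra F"
    and u: "\<And>n. simple_function M (u n)" and f: "simple_function M f"
    and K: "\<And>n. (\<integral>x. u n x * u n x \<partial>M) \<le> K"
    and corr: "\<And>\<delta>. \<delta> > 0 \<Longrightarrow> \<forall>\<^sub>F h in F. \<forall>\<^sub>F n in F. \<bar>\<integral>x. u n x * u (n + h) x \<partial>M\<bar> < \<delta>"
  shows "((\<lambda>n. \<integral>x. f x * u n x \<partial>M) \<longlongrightarrow> 0) F"
proof (rule tendstoI)
  fix \<epsilon> :: real assume "\<epsilon> > 0"
  have "simple_function M (\<lambda>x. - f x)" using f by (rule simple_function_compose1)
  then have "\<forall>\<^sub>F n in F. (\<integral>x. - f x * u n x \<partial>M) < \<epsilon>"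
    by (rule van_der_Corput_upper[OF F u _ K]) (erule corr, fact)
  moreover have "\<forall>\<^sub>F n in F. (\<integral>x. f x * u n x \<partial>M) < \<epsilon>"
    by (rule van_der_Corput_upper[OF F u f K]) (erule corr, fact)
  ultimately show "\<forall>\<^sub>F n in F. dist (\<integral>x. f x * u n x \<partial>M) 0 < \<epsilon>"
    by eventually_elim (simp add: dist_real_def)
qed

end

section \<open>Higher order mixing along an idempotent\<close>

locale prob_preserving = prob_space M for M :: "'a measure" +
  fixes T :: "'a \<Rightarrow> 'a"
  assumes T_measurable: "T \<in> measurable M M"
    and T_preserving: "distr M M T = M"
begin

lemma funpow_measurable: "T ^^ n \<in> measurable M M"
  using T_measurable by (rule measurable_compose_n)

lemma distr_funpow: "distr M M (T ^^ n) = M"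
proof (induction n)
  case 0
  then show ?case by (simp add: distr_id id_def)
next
  case (Suc n)
  have "distr M M (T ^^ Suc n) = distr (distr M M (T ^^ n)) M T"
    unfolding funpow.simps(2) using T_measurable funpow_measurable by (rule distr_distr[symmetric])
  then show ?case by (simp only: Suc T_preserving)
qed

lemma integral_funpow:
  fixes g :: "'a \<Rightarrow> real"
  assumes "simple_function M g"
  shows "(\<integral>x. g ((T ^^ n) x) \<partial>M) = (\<integral>x. g x \<partial>M)"
proof -
  have "(\<integral>x. g x \<partial>distr M M (T ^^ n)) = (\<integral>x. g ((T ^^ n) x) \<partial>M)"
    using assms by (intro integral_distr funpow_measurable borel_measurable_simple_function)
  then show ?thesis by (simp add: distr_funpow)
qed

lemma simple_funpow: "simple_function M g \<Longrightarrow> simple_function M (\<lambda>x. g ((T ^^ n) x))"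
  by (rule simple_function_comp[OF funpow_measurable])

lemma funpow_in_space: "x \<in> space M \<Longrightarrow> (T ^^ n) x \<in> space M"
  by (rule measurable_space[OF funpow_measurable])

lemma indicator_funpow:
  "x \<in> space M \<Longrightarrow> indicator A ((T ^^ n) x) = (indicator (pullback M T n A) x :: real)"
  by (simp add: pullback_def indicator_def)

lemma pullback_sets: "A \<in> sets M \<Longrightarrow> pullback M T n A \<in> sets M"
  unfolding pullback_def using funpow_measurable by (rule measurable_sets)

text \<open>Correlations are bilinear, so their limits pass from indicators to simple functions.\<close>

lemma mixing_simple:
  fixes f g :: "'a \<Rightarrow> real"
  assumes mix: "\<And>A B. A \<in> sets M \<Longrightarrow> B \<in> sets M \<Longrightarrow>
      ((\<lambda>n. prob (A \<inter> pullback M T (\<phi> n) B)) \<longlongrightarrow> prob A * prob B) F"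
    and f: "simple_function M f" and g: "simple_function M g"
  shows "((\<lambda>n. \<integral>x. f x * g ((T ^^ \<phi> n) x) \<partial>M) \<longlongrightarrow> (\<integral>x. f x \<partial>M) * (\<integral>x. g x \<partial>M)) F"
proof -
  define A where "A y = f -` {y} \<inter> space M" for y
  define B where "B y = g -` {y} \<inter> space M" for y
  have fin: "finite (f ` space M)" "finite (g ` space M)"
    using f g by (auto simp: simple_function_def)
  have A[measurable]: "A y \<in> sets M" for y
    unfolding A_def using f by (rule simple_functionD(2))
  have B[measurable]: "B y \<in> sets M" for y
    unfolding B_def using g by (rule simple_functionD(2))
  have repr: "h x = (\<Sum>y\<in>h ` space M. y * indicator (h -` {y} \<inter> space M) x)"
    if "finite (h ` space M)" "x \<in> space M" for h :: "'a \<Rightarrow> real" and x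
  proof -
    have "(\<Sum>y\<in>h ` space M. y * indicator (h -` {y} \<inter> space M) x)
        = (\<Sum>y\<in>h ` space M. if y = h x then y else 0)"
      using that by (intro sum.cong refl) (auto simp: indicator_def)
    also have "\<dots> = h x" using that by simp
    finally show ?thesis by simp
  qed
  have integral: "(\<integral>x. h x \<partial>M) = (\<Sum>y\<in>h ` space M. y * prob (h -` {y} \<inter> space M))"
    if h: "simple_function M h" for h :: "'a \<Rightarrow> real"
  proof -
    have fin: "finite (h ` space M)" using h by (simp add: simple_function_def)
    have level: "h -` {y} \<inter> space M \<in> sets M" for y using h by (rule simple_functionD(2))
    have "(\<integral>x. h x \<partial>M) = (\<integral>x. (\<Sum>y\<in>h ` space M. y * indicator (h -` {y} \<inter> space M) x) \<partial>M)"
      by (intro Bochner_Integration.integral_cong refl repr fin)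
    also have "\<dots> = (\<Sum>y\<in>h ` space M. \<integral>x. y * indicator (h -` {y} \<inter> space M) x \<partial>M)"
      by (intro Bochner_Integration.integral_sum integrable_simple simple_function_mult
            simple_function_const simple_function_indicator level)
    also have "\<dots> = (\<Sum>y\<in>h ` space M. y * prob (h -` {y} \<inter> space M))"
      by (simp add: Int_assoc)
    finally show ?thesis .
  qed
  have corr: "(\<integral>x. f x * g ((T ^^ n) x) \<partial>M)
      = (\<Sum>y\<in>f ` space M. \<Sum>z\<in>g ` space M. y * z * prob (A y \<inter> pullback M T n (B z)))" for n
  proof -
    have "(\<integral>x. f x * g ((T ^^ n) x) \<partial>M) =
        (\<integral>x. (\<Sum>y\<in>f ` space M. \<Sum>z\<in>g ` space M.
                 y * z * indicator (A y \<inter> pullback M T n (B z)) x) \<partial>M)"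
    proof (intro Bochner_Integration.integral_cong refl)
      fix x assume x: "x \<in> space M"
      have "f x * g ((T ^^ n) x) = (\<Sum>y\<in>f ` space M. y * indicator (A y) x)
          * (\<Sum>z\<in>g ` space M. z * indicator (B z) ((T ^^ n) x))"
        unfolding A_def B_def
        using repr[OF fin(1) x] repr[OF fin(2) funpow_in_space[OF x]] by presburger
      also have "\<dots> = (\<Sum>y\<in>f ` space M. \<Sum>z\<in>g ` space M.
                 y * z * indicator (A y \<inter> pullback M T n (B z)) x)"
        by (simp add: sum_product indicator_funpow[OF x] indicator_inter_arith ac_simps)
      finally show "f x * g ((T ^^ n) x) = (\<Sum>y\<in>f ` space M. \<Sum>z\<in>g ` space M.
                 y * z * indicator (A y \<inter> pullback M T n (B z)) x)" .
    qed
    also have "\<dots> = (\<Sum>y\<in>f ` space M. \<Sum>z\<in>g ` space M.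
                       \<integral>x. y * z * indicator (A y \<inter> pullback M T n (B z)) x \<partial>M)"
      by (subst Bochner_Integration.integral_sum;
          intro sum.cong refl Bochner_Integration.integral_sum integrable_simple simple_function_sum
            simple_function_mult simple_function_const simple_function_indicator sets.Int
            pullback_sets A B)
    also have "\<dots> = (\<Sum>y\<in>f ` space M. \<Sum>z\<in>g ` space M.
                       y * z * prob (A y \<inter> pullback M T n (B z)))"
      by (simp add: pullback_sets A B sets.Int sets.Int_space_eq2)
    finally show ?thesis .
  qed
  have "((\<lambda>n. \<Sum>y\<in>f ` space M. \<Sum>z\<in>g ` space M. y * z * prob (A y \<inter> pullback M T (\<phi> n) (B z)))
      \<longlongrightarrow> (\<Sum>y\<in>f ` space M. \<Sum>z\<in>g ` space M. y * z * (prob (A y) * prob (B z)))) F"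
    by (intro tendsto_sum tendsto_mult_left mix A B)
  then show ?thesis
    unfolding corr integral[OF f] integral[OF g] A_def[symmetric] B_def[symmetric] sum_product
    by (simp add: ac_simps)
qed

text \<open>The induction runs over arbitrary finite index sets rather than over \<open>{1..k}\<close>, because its step removes
  the index with the smallest exponent, and it runs over simple functions rather than sets, because
  it passes from \<open>f\<^sub>i\<close> to \<open>f\<^sub>i (f\<^sub>i \<circ> T\<^bsup>h m\<^sub>i\<^esup>)\<close>. The separate factor \<open>f0\<close> is the test function of
  the weak limit. The empty index set starts the induction, and the pair correlations enter in the
  limit over \<open>h\<close>.\<close>

lemma multiple_mixing:
  fixes f :: "'i \<Rightarrow> 'a \<Rightarrow> real"
  assumes F: "idempotent_ultra F"
    and mix: "\<And>j A B. j > 0 \<Longrightarrow> A \<in> sets M \<Longrightarrow> B \<in> sets M \<Longrightarrow>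
      ((\<lambda>n. prob (A \<inter> pullback M T (n * j) B)) \<longlongrightarrow> prob A * prob B) F"
    and "finite I" "inj_on m I" "\<And>i. i \<in> I \<Longrightarrow> m i > 0"
    and "\<And>i. i \<in> I \<Longrightarrow> simple_function M (f i)" "simple_function M f0"
  shows "((\<lambda>n. \<integral>x. f0 x * (\<Prod>i\<in>I. f i ((T ^^ (n * m i)) x)) \<partial>M)
           \<longlongrightarrow> (\<integral>x. f0 x \<partial>M) * (\<Prod>i\<in>I. \<integral>x. f i x \<partial>M)) F"
  using assms(3-)
proof (induction "card I" arbitrary: I m f f0)
  case 0
  then show ?case by simp
next
  case (Suc k)
  note I = \<open>finite I\<close> \<open>inj_on m I\<close> \<open>\<And>i. i \<in> I \<Longrightarrow> m i > 0\<close>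
  note f = \<open>\<And>i. i \<in> I \<Longrightarrow> simple_function M (f i)\<close> and f0 = \<open>simple_function M f0\<close>
  have "I \<noteq> {}" using Suc.hyps(2) by auto
  then obtain i0 where i0: "i0 \<in> I" "\<And>i. i \<in> I \<Longrightarrow> m i0 \<le> m i"
    using ex_min_if_finite[of "m ` I"] I(1) by (auto simp: not_less)
  have less: "m i0 < m i" if "i \<in> I - {i0}" for i
    using that i0 I(2) by (metis Diff_iff inj_onD insertI1 le_neq_implies_less)
  \<comment> \<open>Invariance of the measure cancels \<open>T ^^ (n * m i0)\<close>, which lowers every exponent \<open>m i\<close> by
    \<open>m i0\<close>; the factor at \<open>i0\<close> becomes the test function of the induction hypothesis.\<close>
  have fewer: "((\<lambda>n. \<integral>x. (\<Prod>i\<in>I. g i ((T ^^ (n * m i)) x)) \<partial>M)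
      \<longlongrightarrow> (\<Prod>i\<in>I. \<integral>x. g i x \<partial>M)) F"
    if g: "\<And>i. i \<in> I \<Longrightarrow> simple_function M (g i)" for g :: "'i \<Rightarrow> 'a \<Rightarrow> real"
  proof -
    define J where "J = I - {i0}"
    have J: "I = insert i0 J" "i0 \<notin> J" "finite J" "k = card J"
      using i0 I(1) Suc.hyps(2) by (auto simp: J_def)
    define w where "w n x = g i0 x * (\<Prod>i\<in>J. g i ((T ^^ (n * (m i - m i0))) x))" for n x
    have w: "simple_function M (w n)" for n
      unfolding w_def using g J(1)
      by (intro simple_function_mult simple_function_prod simple_funpow) auto
    have "(\<Prod>i\<in>I. g i ((T ^^ (n * m i)) x)) = w n ((T ^^ (n * m i0)) x)" for n x
    proof -
      have "(T ^^ (n * m i)) x = (T ^^ (n * (m i - m i0))) ((T ^^ (n * m i0)) x)" if "i \<in> J" for i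
      proof -
        have "n * m i = n * (m i - m i0) + n * m i0"
          using less[of i] that by (simp add: J_def flip: distrib_left)
        then show ?thesis by (simp add: funpow_add)
      qed
      then show ?thesis using J by (simp add: w_def)
    qed
    then have "(\<integral>x. (\<Prod>i\<in>I. g i ((T ^^ (n * m i)) x)) \<partial>M) = (\<integral>x. w n x \<partial>M)" for n
      by (simp add: integral_funpow[OF w])
    moreover have "((\<lambda>n. \<integral>x. w n x \<partial>M)
        \<longlongrightarrow> (\<integral>x. g i0 x \<partial>M) * (\<Prod>i\<in>J. \<integral>x. g i x \<partial>M)) F"
      unfolding w_def
    proof (rule Suc.hyps(1)[OF J(4)])
      show "inj_on (\<lambda>i. m i - m i0) J"
      proof (rule inj_onI)
        fix i j assume ij: "i \<in> J" "j \<in> J" "m i - m i0 = m j - m i0"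
        then have "i \<in> I" "j \<in> I" by (auto simp: J_def)
        moreover from this have "m i = m j" using ij(3) i0(2)[of i] i0(2)[of j] by simp
        ultimately show "i = j" using I(2) by (simp add: inj_on_def)
      qed
    qed (use J(3) i0(1) g less in \<open>auto simp: J_def\<close>)
    ultimately show ?thesis using J by simp
  qed
  define c where "c = (\<Prod>i\<in>I. \<integral>x. f i x \<partial>M)"
  define P where "P n x = (\<Prod>i\<in>I. f i ((T ^^ (n * m i)) x))" for n x
  define u where "u n x = P n x - c" for n x
  have P: "simple_function M (P n)" for n
    unfolding P_def using f by (intro simple_function_prod simple_funpow)
  have u: "simple_function M (u n)" for n
    unfolding u_def using P by (intro simple_function_diff) auto
  have int: "integrable M (\<lambda>x. g x * h x)" if "simple_function M g" "simple_function M h"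
    for g h :: "'a \<Rightarrow> real" using that by (intro integrable_simple simple_function_mult)
  have "\<exists>K. \<forall>n. (\<integral>x. u n x * u n x \<partial>M) \<le> K"
  proof -
    have "\<exists>b. \<forall>x\<in>space M. \<bar>f i x\<bar> \<le> b" if "i \<in> I" for i
    proof -
      have "finite (abs ` f i ` space M)"
        using f[OF that] by (simp add: simple_function_def)
      then have "\<bar>f i x\<bar> \<le> Max (abs ` f i ` space M)" if "x \<in> space M" for x
        using that by (intro Max_ge) auto
      then show ?thesis by blast
    qed
    then obtain b where b: "\<And>i x. i \<in> I \<Longrightarrow> x \<in> space M \<Longrightarrow> \<bar>f i x\<bar> \<le> b i" by metis
    define K where "K = (\<Prod>i\<in>I. b i) + \<bar>c\<bar>"
    have bound: "\<bar>u n x\<bar> \<le> K" if "x \<in> space M" for n x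
    proof -
      have "\<bar>P n x\<bar> \<le> (\<Prod>i\<in>I. b i)"
        unfolding P_def abs_prod using b funpow_in_space that by (intro prod_mono) auto
      then show ?thesis unfolding u_def K_def by linarith
    qed
    have "(\<integral>x. u n x * u n x \<partial>M) \<le> K * K" for n
    proof (rule integral_le_const)
      show "AE x in M. u n x * u n x \<le> K * K"
      proof (rule AE_I2)
        fix x assume "x \<in> space M"
        from mult_mono[OF bound[OF this, of n] bound[OF this, of n]]
        show "u n x * u n x \<le> K * K" using bound[OF \<open>x \<in> space M\<close>, of n] by (simp flip: abs_mult)
      qed
    qed (use int u in auto)
    then show ?thesis by blast
  qed
  then obtain K where K: "\<And>n. (\<integral>x. u n x * u n x \<partial>M) \<le> K" by blast
  define D where "D h = (\<Prod>i\<in>I. \<integral>x. f i x * f i ((T ^^ (h * m i)) x) \<partial>M) - c * c" for h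
  \<comment> \<open>Regrouping the product of \<open>P n\<close> and \<open>P (n + h)\<close> by index leaves a single product over \<open>I\<close>,
    whose factors are \<open>f i * f i \<circ> T ^^ (h * m i)\<close> composed with \<open>T ^^ (n * m i)\<close>.\<close>
  have lim_n: "((\<lambda>n. \<integral>x. u n x * u (n + h) x \<partial>M) \<longlongrightarrow> D h) F" for h
  proof -
    have shift: "P (n + h) x = (\<Prod>i\<in>I. f i ((T ^^ (h * m i)) ((T ^^ (n * m i)) x)))" for n x
    proof -
      have "(n + h) * m i = h * m i + n * m i" for i by (simp add: distrib_right)
      then show ?thesis by (simp add: P_def funpow_add)
    qed
    have one: "((\<lambda>n. \<integral>x. P n x \<partial>M) \<longlongrightarrow> c) F"
      unfolding P_def c_def using f by (rule fewer)
    have two: "((\<lambda>n. \<integral>x. P (n + h) x \<partial>M) \<longlongrightarrow> c) F"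
    proof -
      have "((\<lambda>n. \<integral>x. P (n + h) x \<partial>M)
          \<longlongrightarrow> (\<Prod>i\<in>I. \<integral>x. f i ((T ^^ (h * m i)) x) \<partial>M)) F"
        unfolding shift
        by (rule fewer[of "\<lambda>i x. f i ((T ^^ (h * m i)) x)"]) (use f simple_funpow in blast)
      then show ?thesis by (simp add: integral_funpow f c_def cong: prod.cong)
    qed
    have both: "((\<lambda>n. \<integral>x. P n x * P (n + h) x \<partial>M) \<longlongrightarrow> D h + c * c) F"
    proof -
      have "((\<lambda>n. \<integral>x. (\<Prod>i\<in>I. f i ((T ^^ (n * m i)) x) * f i ((T ^^ (h * m i)) ((T ^^ (n * m i)) x))) \<partial>M)
          \<longlongrightarrow> (\<Prod>i\<in>I. \<integral>x. f i x * f i ((T ^^ (h * m i)) x) \<partial>M)) F"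
        by (rule fewer[of "\<lambda>i x. f i x * f i ((T ^^ (h * m i)) x)"])
           (use f simple_funpow simple_function_mult in blast)
      then show ?thesis by (simp add: shift D_def prod.distrib) (simp add: P_def)
    qed
    have "(\<integral>x. u n x * u (n + h) x \<partial>M) = (\<integral>x. P n x * P (n + h) x \<partial>M)
        - c * (\<integral>x. P n x \<partial>M) - c * (\<integral>x. P (n + h) x \<partial>M) + c * c" for n
    proof -
      have "(\<integral>x. u n x * u (n + h) x \<partial>M)
          = (\<integral>x. P n x * P (n + h) x - c * P n x - c * P (n + h) x + c * c \<partial>M)"
        by (simp add: u_def algebra_simps)
      also have "\<dots> = (\<integral>x. P n x * P (n + h) x \<partial>M)
          - c * (\<integral>x. P n x \<partial>M) - c * (\<integral>x. P (n + h) x \<partial>M) + c * c"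
        using int P integrable_simple by (simp add: prob_space)
      finally show ?thesis .
    qed
    moreover have "((\<lambda>n. (\<integral>x. P n x * P (n + h) x \<partial>M)
        - c * (\<integral>x. P n x \<partial>M) - c * (\<integral>x. P (n + h) x \<partial>M) + c * c)
        \<longlongrightarrow> (D h + c * c) - c * c - c * c + c * c) F"
      by (intro tendsto_intros both one two)
    ultimately show ?thesis by simp
  qed
  have lim_h: "(D \<longlongrightarrow> 0) F"
  proof -
    have "((\<lambda>h. \<Prod>i\<in>I. \<integral>x. f i x * f i ((T ^^ (h * m i)) x) \<partial>M)
        \<longlongrightarrow> (\<Prod>i\<in>I. (\<integral>x. f i x \<partial>M) * (\<integral>x. f i x \<partial>M))) F"
    proof (rule tendsto_prod)
      fix i assume i: "i \<in> I"
      show "((\<lambda>h. \<integral>x. f i x * f i ((T ^^ (h * m i)) x) \<partial>M)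
          \<longlongrightarrow> (\<integral>x. f i x \<partial>M) * (\<integral>x. f i x \<partial>M)) F"
        using mix[OF I(3)[OF i]] f[OF i] f[OF i] by (rule mixing_simple)
    qed
    then have "(D \<longlongrightarrow> (\<Prod>i\<in>I. (\<integral>x. f i x \<partial>M) * (\<integral>x. f i x \<partial>M)) - c * c) F"
      unfolding D_def by (rule tendsto_diff[OF _ tendsto_const])
    then show ?thesis by (simp add: c_def prod.distrib)
  qed
  have "((\<lambda>n. \<integral>x. f0 x * u n x \<partial>M) \<longlongrightarrow> 0) F"
  proof (rule van_der_Corput[OF F u f0 K])
    fix \<delta> :: real assume "\<delta> > 0"
    have "\<forall>\<^sub>F h in F. \<bar>D h\<bar> < \<delta>"
      using tendstoD[OF lim_h \<open>\<delta> > 0\<close>] by (simp add: dist_real_def)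
    then show "\<forall>\<^sub>F h in F. \<forall>\<^sub>F n in F. \<bar>\<integral>x. u n x * u (n + h) x \<partial>M\<bar> < \<delta>"
    proof eventually_elim
      case (elim h)
      with tendsto_rabs[OF lim_n[of h]] show ?case by (rule order_tendstoD(2))
    qed
  qed
  then have "((\<lambda>n. (\<integral>x. f0 x * u n x \<partial>M) + c * (\<integral>x. f0 x \<partial>M)) \<longlongrightarrow> 0 + c * (\<integral>x. f0 x \<partial>M)) F"
    by (intro tendsto_intros)
  moreover have "(\<integral>x. f0 x * u n x \<partial>M) + c * (\<integral>x. f0 x \<partial>M) = (\<integral>x. f0 x * P n x \<partial>M)" for n
  proof -
    have "(\<integral>x. f0 x * P n x \<partial>M) = (\<integral>x. f0 x * u n x + c * f0 x \<partial>M)"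
      by (simp add: u_def algebra_simps)
    also have "\<dots> = (\<integral>x. f0 x * u n x \<partial>M) + c * (\<integral>x. f0 x \<partial>M)"
      using int[OF f0 u] integrable_simple[OF f0] by simp
    finally show ?thesis by simp
  qed
  ultimately show ?case by (simp add: P_def c_def mult.commute)
qed

lemma multiple_mixing_sets:
  fixes A :: "nat \<Rightarrow> 'a set"
  assumes F: "idempotent_ultra F"
    and mix: "\<And>j A B. j > 0 \<Longrightarrow> A \<in> sets M \<Longrightarrow> B \<in> sets M \<Longrightarrow>
      ((\<lambda>n. prob (A \<inter> pullback M T (n * j) B)) \<longlongrightarrow> prob A * prob B) F"
    and A: "\<And>i. i \<le> k \<Longrightarrow> A i \<in> sets M"
    and m: "strict_mono_on {1..k} m" "\<And>i. i \<in> {1..k} \<Longrightarrow> m i > 0"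
  shows "((\<lambda>n. prob (A 0 \<inter> (\<Inter>i\<in>{1..k}. pullback M T (n * m i) (A i))))
           \<longlongrightarrow> (\<Prod>i=0..k. prob (A i))) F"
proof -
  have "((\<lambda>n. \<integral>x. indicator (A 0) x * (\<Prod>i\<in>{1..k}. indicator (A i) ((T ^^ (n * m i)) x)) \<partial>M)
      \<longlongrightarrow> (\<integral>x. indicator (A 0) x \<partial>M) * (\<Prod>i\<in>{1..k}. \<integral>x. indicat_real (A i) x \<partial>M)) F"
    by (rule multiple_mixing[OF F mix])
       (use A m strict_mono_on_imp_inj_on in \<open>auto intro: simple_function_indicator\<close>)
  moreover have "(\<integral>x. indicator (A 0) x * (\<Prod>i\<in>{1..k}. indicator (A i) ((T ^^ (n * m i)) x)) \<partial>M)
      = prob (A 0 \<inter> (\<Inter>i\<in>{1..k}. pullback M T (n * m i) (A i)))" for n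
  proof -
    let ?E = "A 0 \<inter> (\<Inter>i\<in>{1..k}. pullback M T (n * m i) (A i))"
    have "(\<integral>x. indicator (A 0) x * (\<Prod>i\<in>{1..k}. indicator (A i) ((T ^^ (n * m i)) x)) \<partial>M)
        = (\<integral>x. (indicator ?E x :: real) \<partial>M)"
    proof (intro Bochner_Integration.integral_cong refl)
      fix x assume x: "x \<in> space M"
      have "(\<Prod>i\<in>J. indicator (pullback M T (n * m i) (A i)) x)
          = indicat_real (\<Inter>i\<in>J. pullback M T (n * m i) (A i)) x" if "finite J" for J
        using that by induction (auto simp: indicator_inter_arith)
      then show "indicator (A 0) x * (\<Prod>i\<in>{1..k}. indicator (A i) ((T ^^ (n * m i)) x))
          = (indicator ?E x :: real)"
        by (simp add: indicator_funpow[OF x] indicator_inter_arith)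
    qed
    also have "?E \<in> sets M"
    proof (cases "k = 0")
      case False
      then show ?thesis
        using A by (intro sets.Int sets.finite_INT pullback_sets) auto
    qed (use A in simp)
    then have "(\<integral>x. (indicator ?E x :: real) \<partial>M) = prob ?E" by simp
    finally show ?thesis .
  qed
  moreover have "(\<Prod>i=0..k. prob (A i)) = prob (A 0) * (\<Prod>i\<in>{1..k}. prob (A i))"
    by (simp add: prod.atLeast_Suc_atMost)
  ultimately show ?thesis using A by simp
qed

end

section \<open>Mixing along the essential idempotents\<close>

text \<open>Mixing speaks only of sets of positive measure; when one of the two sets is null, all
  the correlations vanish because \<open>T\<close> preserves the measure.\<close>

lemma essential_star_mixing_tendsto:
  assumes mix: "essential_star_mixing \<F> M T" and M: "prob_preserving M T"
    and p: "p \<in> beta_family \<F>" "uf_plus p p = p"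
    and A: "A \<in> sets M" and B: "B \<in> sets M"
  shows "((\<lambda>n. measure M (A \<inter> pullback M T n B)) \<longlongrightarrow> measure M A * measure M B) (filter_of_uf p)"
proof -
  interpret prob_preserving M T by (rule M)
  show ?thesis
  proof (cases "prob A * prob B > 0")
    case True
    show ?thesis
    proof (rule tendstoI)
      fix \<epsilon> :: real assume "\<epsilon> > 0"
      then have "essential_star_set \<F> {n \<in> \<nat>\<^sub>1. \<bar>prob (A \<inter> pullback M T n B) - prob A * prob B\<bar> < \<epsilon>}"
        using mix A B True unfolding essential_star_mixing_def by blast
      then show "\<forall>\<^sub>F n in filter_of_uf p. dist (prob (A \<inter> pullback M T n B)) (prob A * prob B) < \<epsilon>"
        using p unfolding essential_star_set_Collect_iff dist_real_def by blast
    qed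
  next
    case False
    then have null: "prob A = 0 \<or> prob B = 0"
      using measure_nonneg[of M A] measure_nonneg[of M B] by (auto simp: less_le)
    have preserved: "prob (pullback M T n B) = prob B" for n
      using measure_distr[OF funpow_measurable B, of n] by (simp add: distr_funpow pullback_def)
    have "prob (A \<inter> pullback M T n B) \<le> prob A"
      "prob (A \<inter> pullback M T n B) \<le> prob (pullback M T n B)" for n
      using A B by (auto intro!: finite_measure_mono pullback_sets)
    then have "prob (A \<inter> pullback M T n B) \<le> 0" for n
      using null preserved[of n] by (metis (no_types))
    then have "prob (A \<inter> pullback M T n B) = 0" for n
      using measure_nonneg by (rule order_antisym)
    then show ?thesis using null by auto
  qed
qed

lemma essential_star_mixing_tendsto_dilate:
  assumes \<F>: "family \<F>" "dilation_invariant \<F>"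
    and mix: "essential_star_mixing \<F> M T" and M: "prob_preserving M T"
    and p: "p \<in> beta_family \<F>" "uf_plus p p = p" and j: "j > 0"
    and A: "A \<in> sets M" and B: "B \<in> sets M"
  shows "((\<lambda>n. measure M (A \<inter> pullback M T (n * j) B)) \<longlongrightarrow> measure M A * measure M B)
           (filter_of_uf p)"
proof -
  have j: "j \<in> \<nat>\<^sub>1" using j by simp
  have beta: "p \<in> betaN" using p by (simp add: beta_family_def)
  have "((\<lambda>n. measure M (A \<inter> pullback M T n B)) \<longlongrightarrow> measure M A * measure M B)
      (filter_of_uf (dilate_uf j p))"
    using mix M dilate_uf_beta_family[OF \<F> p(1) j] dilate_uf_idempotent[OF beta p(2) j] A B
    by (rule essential_star_mixing_tendsto)
  then show ?thesis
    unfolding tendsto_iff eventually_filter_of_dilate_uf[OF beta j] by (simp add: mult.commute)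
qed

theorem theorem5p9:
  fixes \<F> :: "nat set set"
    and M :: "'a measure" and d :: "'a \<Rightarrow> 'a \<Rightarrow> real" and T :: "'a \<Rightarrow> 'a"
  assumes "family \<F>" and "translation_invariant \<F>" and "dilation_invariant \<F>"
    and "ramsey_property \<F>"
    and "measure_preserving_system M d T"
  shows "essential_star_mixing \<F> M T \<longleftrightarrow>
    (\<forall>k\<in>\<nat>\<^sub>1. \<forall>(A :: nat \<Rightarrow> 'a set) (m :: nat \<Rightarrow> nat) (\<epsilon>::real).
       (\<forall>i\<in>{0..k}. A i \<in> sets M) \<longrightarrow>
       (\<Prod>i=0..k. measure M (A i)) > 0 \<longrightarrow>
       (\<forall>i\<in>{1..k}. m i \<in> \<nat>\<^sub>1) \<longrightarrow>
       strict_mono_on {1..k} m \<longrightarrow>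
       \<epsilon> > 0 \<longrightarrow>
       essential_star_set \<F>
         {n \<in> \<nat>\<^sub>1. \<bar>measure M (A 0 \<inter> (\<Inter>i\<in>{1..k}. pullback M T (n * m i) (A i)))
                  - (\<Prod>i=0..k. measure M (A i))\<bar> < \<epsilon>})"
proof
  assume mix: "essential_star_mixing \<F> M T"
  interpret measure_preserving_system M d T by (rule assms)
  have PT: "prob_preserving M T"
    using lebesgue T_measurable T_preserving
    by (auto simp: lebesgue_prob_space_def prob_preserving_def prob_preserving_axioms_def)
  show "\<forall>k\<in>\<nat>\<^sub>1. \<forall>(A :: nat \<Rightarrow> 'a set) (m :: nat \<Rightarrow> nat) (\<epsilon>::real).
       (\<forall>i\<in>{0..k}. A i \<in> sets M) \<longrightarrow>
       (\<Prod>i=0..k. measure M (A i)) > 0 \<longrightarrow>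
       (\<forall>i\<in>{1..k}. m i \<in> \<nat>\<^sub>1) \<longrightarrow>
       strict_mono_on {1..k} m \<longrightarrow>
       \<epsilon> > 0 \<longrightarrow>
       essential_star_set \<F>
         {n \<in> \<nat>\<^sub>1. \<bar>measure M (A 0 \<inter> (\<Inter>i\<in>{1..k}. pullback M T (n * m i) (A i)))
                  - (\<Prod>i=0..k. measure M (A i))\<bar> < \<epsilon>}"
    unfolding essential_star_set_Collect_iff
  proof (intro ballI allI impI)
    fix k and A :: "nat \<Rightarrow> 'a set" and m :: "nat \<Rightarrow> nat" and \<epsilon> p
    assume A: "\<forall>i\<in>{0..k}. A i \<in> sets M" and m: "\<forall>i\<in>{1..k}. m i \<in> \<nat>\<^sub>1" "strict_mono_on {1..k} m"
      and \<epsilon>: "(\<epsilon>::real) > 0" and p: "p \<in> beta_family \<F>" "uf_plus p p = p"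
    interpret prob_preserving M T by (rule PT)
    have F: "idempotent_ultra (filter_of_uf p)"
      using p by (simp add: beta_family_def idempotent_ultra_filter_of_uf)
    have "((\<lambda>n. measure M (A 0 \<inter> (\<Inter>i\<in>{1..k}. pullback M T (n * m i) (A i))))
        \<longlongrightarrow> (\<Prod>i=0..k. measure M (A i))) (filter_of_uf p)"
    proof (rule multiple_mixing_sets[OF F])
      fix j :: nat and B C assume "j > 0" "B \<in> events" "C \<in> events"
      then show "((\<lambda>n. prob (B \<inter> pullback M T (n * j) C)) \<longlongrightarrow> prob B * prob C) (filter_of_uf p)"
        by (rule essential_star_mixing_tendsto_dilate[OF assms(1,3) mix PT p])
    qed (use A m in \<open>auto simp: Suc_le_eq\<close>)
    from tendstoD[OF this \<epsilon>]
    show "\<forall>\<^sub>F n in filter_of_uf p. \<bar>measure M (A 0 \<inter> (\<Inter>i\<in>{1..k}. pullback M T (n * m i) (A i)))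
        - (\<Prod>i=0..k. measure M (A i))\<bar> < \<epsilon>"
      by (simp add: dist_real_def)
  qed
next
  assume multi: "\<forall>k\<in>\<nat>\<^sub>1. \<forall>(A :: nat \<Rightarrow> 'a set) (m :: nat \<Rightarrow> nat) (\<epsilon>::real).
       (\<forall>i\<in>{0..k}. A i \<in> sets M) \<longrightarrow>
       (\<Prod>i=0..k. measure M (A i)) > 0 \<longrightarrow>
       (\<forall>i\<in>{1..k}. m i \<in> \<nat>\<^sub>1) \<longrightarrow>
       strict_mono_on {1..k} m \<longrightarrow>
       \<epsilon> > 0 \<longrightarrow>
       essential_star_set \<F>
         {n \<in> \<nat>\<^sub>1. \<bar>measure M (A 0 \<inter> (\<Inter>i\<in>{1..k}. pullback M T (n * m i) (A i)))
                  - (\<Prod>i=0..k. measure M (A i))\<bar> < \<epsilon>}"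
  show "essential_star_mixing \<F> M T"
    unfolding essential_star_mixing_def
  proof (intro ballI allI impI)
    fix A B and \<epsilon> :: real
    assume *: "A \<in> sets M" "B \<in> sets M" "\<epsilon> > 0" "measure M A * measure M B > 0"
    define C where "C i = (if i = 0 then A else B)" for i :: nat
    have prod: "(\<Prod>i=0..1. measure M (C i)) = measure M A * measure M B"
      by (simp add: C_def)
    have "essential_star_set \<F>
         {n \<in> \<nat>\<^sub>1. \<bar>measure M (C 0 \<inter> (\<Inter>i\<in>{1..1}. pullback M T (n * 1) (C i)))
                  - (\<Prod>i=0..1. measure M (C i))\<bar> < \<epsilon>}"
    proof (rule multi[rule_format, of 1 C "\<lambda>_. 1" \<epsilon>])
      show "0 < (\<Prod>i=0..1. measure M (C i))" unfolding prod by fact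
    qed (use * in \<open>auto simp: C_def strict_mono_on_def\<close>)
    then show "essential_star_set \<F>
        {n \<in> \<nat>\<^sub>1. \<bar>measure M (A \<inter> pullback M T n B) - measure M A * measure M B\<bar> < \<epsilon>}"
      unfolding prod by (simp add: C_def)
  qed
qed

end
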